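(* Let $(X,\tau_1,\tau_2)$ be a bitopological space with $\tau_1\subset\tau_2$. Then $(X,\tau_1,\tau_2)$ is $1$-scattered if and only if it is $p$-scattered. Moreover, in the class of $1$-scattered (equivalently, $p$-scattered) bitopological spaces $(X,\tau_1,\tau_2)$ with $\tau_1\subset\tau_2$, the following conditions are equivalent: (1) $(X,\tau_1,\tau_2)$ is a $1$-$I$-space. (2) $(X,\tau_1,\tau_2)$ is $d$-submaximal and $p$-submaximal. (3) $(X,\tau_1,\tau_2)$ is $1$-nodec.
   Context: A bitopological space is a set with two topologies $\tau_1,\tau_2$; let $i,j\in\{1,2\}$. For $A\subset X$, $A_i^d$ is the set of $\tau_i$-accumulation points of $A$ in $X$, and $A_i^i=A\setminus A_i^d$ is the set of $\tau_i$-isolated points of $A$ (the upper index $i$ is a fixed symbol for "isolated"). $A$ is $i$-discrete if $A=A_i^i$. $1$-scattered: $X\neq\varnothing$ and the only subset $B\subset X$ with $B\subset B_1^d$ is $B=\varnothing$. $p$-scattered: $X\neq\varnothing$ and the only subset $B\subset X$ that is $p$-dense in itself is $B=\varnothing$. Here, for $i\neq j$, $B$ is $(i,j)$-dense in itself if $B_i^i\subset B_j^d$, and $B$ is $p$-dense in itself if it is both $(1,2)$- and $(2,1)$-dense in itself. $1$-$I$-space: the derived set $X_1^d$ is $\tau_1$-closed and $1$-discrete. $1$-nodec: every $\tau_1$-nowhere dense subset of $X$ is $\tau_1$-closed and $1$-discrete. For $i\neq j$, $(X,\tau_1,\tau_2)$ is $(i,j)$-submaximal if every subset of $X$ has the form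 $U\cap F$ with $U$ $\tau_i$-open and $F$ $\tau_j$-closed. It is $i$-submaximal if every subset of $X$ is the intersection of a $\tau_i$-open set and a $\tau_i$-closed set. It is $d$-submaximal if it is both $1$-submaximal and $2$-submaximal, and $p$-submaximal if it is both $(1,2)$-submaximal and $(2,1)$-submaximal. *)

theory Defs
  imports "HOL-Analysis.Analysis"
begin

(* A bitopological space (X, tau_1, tau_2) is a pair of topologies T1, T2 with the common carrier
   topspace T1 = topspace T2 = X. A notion indexed by i takes the topology T_i, one indexed by (i, j)
   takes T_i and T_j in this order. A_i^d is  T_i derived_set_of A. *)

definition bitopological_space :: "'a topology \<Rightarrow> 'a topology \<Rightarrow> bool" where
  "bitopological_space T1 T2 \<longleftrightarrow> topspace T1 = topspace T2"

definition coarser_topology :: "'a topology \<Rightarrow> 'a topology \<Rightarrow> bool" where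
  "coarser_topology T1 T2 \<longleftrightarrow> {U. openin T1 U} \<subseteq> {U. openin T2 U}"

definition isolated_points :: "'a topology \<Rightarrow> 'a set \<Rightarrow> 'a set" where
  "isolated_points T A = A - T derived_set_of A"

definition discrete_set :: "'a topology \<Rightarrow> 'a set \<Rightarrow> bool" where
  "discrete_set T A \<longleftrightarrow> A = isolated_points T A"

definition nowhere_dense :: "'a topology \<Rightarrow> 'a set \<Rightarrow> bool" where
  "nowhere_dense T A \<longleftrightarrow> T interior_of (T closure_of A) = {}"

definition scattered :: "'a topology \<Rightarrow> bool" where
  "scattered T \<longleftrightarrow> topspace T \<noteq> {} \<and>
     (\<forall>B \<subseteq> topspace T. B \<subseteq> T derived_set_of B \<longrightarrow> B = {})"

definition ij_dense_in_itself :: "'a topology \<Rightarrow> 'a topology \<Rightarrow> 'a set \<Rightarrow> bool" where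
  "ij_dense_in_itself Ti Tj B \<longleftrightarrow> isolated_points Ti B \<subseteq> Tj derived_set_of B"

definition p_dense_in_itself :: "'a topology \<Rightarrow> 'a topology \<Rightarrow> 'a set \<Rightarrow> bool" where
  "p_dense_in_itself T1 T2 B \<longleftrightarrow> ij_dense_in_itself T1 T2 B \<and> ij_dense_in_itself T2 T1 B"

definition p_scattered :: "'a topology \<Rightarrow> 'a topology \<Rightarrow> bool" where
  "p_scattered T1 T2 \<longleftrightarrow> topspace T1 \<noteq> {} \<and>
     (\<forall>B \<subseteq> topspace T1. p_dense_in_itself T1 T2 B \<longrightarrow> B = {})"

definition I_space :: "'a topology \<Rightarrow> bool" where
  "I_space T \<longleftrightarrow>
     closedin T (T derived_set_of topspace T) \<and> discrete_set T (T derived_set_of topspace T)"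

definition nodec :: "'a topology \<Rightarrow> bool" where
  "nodec T \<longleftrightarrow>
     (\<forall>A \<subseteq> topspace T. nowhere_dense T A \<longrightarrow> closedin T A \<and> discrete_set T A)"

definition submaximal :: "'a topology \<Rightarrow> bool" where
  "submaximal T \<longleftrightarrow>
     (\<forall>A \<subseteq> topspace T. \<exists>U F. openin T U \<and> closedin T F \<and> A = U \<inter> F)"

definition ij_submaximal :: "'a topology \<Rightarrow> 'a topology \<Rightarrow> bool" where
  "ij_submaximal Ti Tj \<longleftrightarrow>
     (\<forall>A \<subseteq> topspace Ti. \<exists>U F. openin Ti U \<and> closedin Tj F \<and> A = U \<inter> F)"

definition d_submaximal :: "'a topology \<Rightarrow> 'a topology \<Rightarrow> bool" where
  "d_submaximal T1 T2 \<longleftrightarrow> submaximal T1 \<and> submaximal T2"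

definition p_submaximal :: "'a topology \<Rightarrow> 'a topology \<Rightarrow> bool" where
  "p_submaximal T1 T2 \<longleftrightarrow> ij_submaximal T1 T2 \<and> ij_submaximal T2 T1"

end

theory Submission
  imports Defs
begin

text \<open>
  Since \<open>\<tau>\<^sub>1 \<subseteq> \<tau>\<^sub>2\<close>, one has \<open>B\<^sub>2\<^sup>d \<subseteq> B\<^sub>1\<^sup>d\<close>, so that being
  \<open>p\<close>-dense in itself, that is \<open>B \<subseteq> B\<^sub>1\<^sup>d \<union> B\<^sub>2\<^sup>d\<close>, collapses to \<open>B \<subseteq> B\<^sub>1\<^sup>d\<close>.
  For the equivalences only \<open>\<tau>\<^sub>1\<close> matters. In an \<open>I\<close>-space every set of isolated points is
  open and every subset of \<open>X\<^sup>d\<close> is closed, and this decomposes an arbitrary set as \<open>U \<inter> F\<close>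
  in \<open>\<tau>\<^sub>1\<close>, hence in every combination of the two topologies. In a submaximal space dense sets are
  open, so all subsets of a nowhere dense set are closed. Finally, in a scattered space \<open>X\<^sup>d\<close>
  is nowhere dense, because its interior is dense in itself.
\<close>

lemma derived_set_of_antimono_topology:
  assumes "topspace T1 = topspace T2" and "\<And>U. openin T1 U \<Longrightarrow> openin T2 U"
  shows "T2 derived_set_of B \<subseteq> T1 derived_set_of B"
proof
  fix x assume "x \<in> T2 derived_set_of B"
  then show "x \<in> T1 derived_set_of B"
    using assms(1) assms(2) by (simp add: in_derived_set_of)
qed

text \<open>Both halves of the definition unfold to one symmetric condition: a point of
  \<open>B\<close> outside one derived set lies in the other.\<close>

lemma p_dense_in_itself_iff:
  "p_dense_in_itself T1 T2 B \<longleftrightarrow> B \<subseteq> T1 derived_set_of B \<union> T2 derived_set_of B"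
  unfolding p_dense_in_itself_def ij_dense_in_itself_def isolated_points_def by blast

lemma openin_singleton_iff_not_derived:
  assumes "x \<in> topspace T"
  shows "openin T {x} \<longleftrightarrow> x \<notin> T derived_set_of topspace T"
proof
  assume "x \<notin> T derived_set_of topspace T"
  then obtain U where U: "openin T U" "x \<in> U" "\<not> (\<exists>y. y \<noteq> x \<and> y \<in> topspace T \<and> y \<in> U)"
    using assms unfolding in_derived_set_of by blast
  then have "U = {x}"
    using openin_subset by blast
  with U show "openin T {x}"
    by simp
next
  assume "openin T {x}"
  then show "x \<notin> T derived_set_of topspace T"
    unfolding in_derived_set_of by blast
qed

lemma openin_isolated_subset:
  assumes "A \<subseteq> topspace T - T derived_set_of topspace T"
  shows "openin T A"
proof -
  have "openin T (\<Union>x\<in>A. {x})"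
    using assms openin_singleton_iff_not_derived[of _ T] by (intro openin_Union) auto
  then show ?thesis
    by simp
qed

text \<open>The complement is a union of open singletons.\<close>

lemma closedin_derived_set_of_topspace: "closedin T (T derived_set_of topspace T)"
  using derived_set_of_subset_topspace[of T] openin_isolated_subset[OF subset_refl, of T]
  by (simp add: closedin_def)

text \<open>Closedness puts the accumulation points of \<open>D\<close> inside \<open>D\<close>,
  discreteness keeps them outside, so neither \<open>D\<close> nor \<open>A\<close> has any.\<close>

lemma closedin_subset_of_closed_discrete:
  assumes "closedin T D" "discrete_set T D" "A \<subseteq> D"
  shows "closedin T A"
proof -
  have "T derived_set_of D = {}"
    using assms(1,2) unfolding closedin_contains_derived_set discrete_set_def isolated_points_def
    by blast
  then have "T derived_set_of A = {}"
    using derived_set_of_mono[OF \<open>A \<subseteq> D\<close>, of T] by blast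
  then show ?thesis
    using assms(3) closedin_subset[OF assms(1)] by (simp add: closedin_contains_derived_set)
qed

lemma I_space_locally_closed:
  assumes "I_space T" "A \<subseteq> topspace T"
  obtains U F where "openin T U" "closedin T F" "A = U \<inter> F"
proof
  let ?D = "T derived_set_of topspace T"
  have "closedin T (?D - A)"
    using closedin_subset_of_closed_discrete[of T ?D "?D - A"] assms(1)
    unfolding I_space_def by blast
  \<comment> \<open>\<open>U\<close> removes the accumulation points of the space outside
    \<open>A\<close>, \<open>F\<close> the isolated points outside \<open>A\<close>.\<close>
  then show "openin T (topspace T - (?D - A))"
    by blast
  show "closedin T (topspace T - (topspace T - ?D - A))"
    by (intro closedin_diff closedin_topspace openin_isolated_subset) auto
  show "A = (topspace T - (?D - A)) \<inter> (topspace T - (topspace T - ?D - A))"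
    using assms(2) by blast
qed

lemma submaximal_dense_openin:
  assumes "submaximal T" "A \<subseteq> topspace T" "T closure_of A = topspace T"
  shows "openin T A"
proof -
  obtain U F where UF: "openin T U" "closedin T F" "A = U \<inter> F"
    using assms(1,2) unfolding submaximal_def by blast
  then have "topspace T \<subseteq> F"
    using assms(3) closure_of_minimal[of A F T] by auto
  then have "A = U"
    using UF openin_subset[of T U] by blast
  with UF show ?thesis
    by simp
qed

lemma submaximal_nowhere_dense_closedin:
  assumes "submaximal T" "A \<subseteq> topspace T" "nowhere_dense T A"
  shows "closedin T A"
proof -
  have "T interior_of A = {}"
    using assms(3) interior_of_mono[OF closure_of_subset[OF assms(2)], of T]
    unfolding nowhere_dense_def by blast
  then have "T closure_of (topspace T - A) = topspace T"
    by (simp add: closure_of_complement)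
  then show ?thesis
    using submaximal_dense_openin[OF assms(1)] assms(2) by (simp add: closedin_def)
qed

lemma nowhere_dense_subset:
  assumes "nowhere_dense T A" "B \<subseteq> A"
  shows "nowhere_dense T B"
  using assms interior_of_mono[OF closure_of_mono[OF \<open>B \<subseteq> A\<close>, of T], of T]
  unfolding nowhere_dense_def by blast

lemma discrete_set_if_subsets_closedin:
  assumes "\<And>B. B \<subseteq> A \<Longrightarrow> closedin T B"
  shows "discrete_set T A"
proof -
  have "x \<notin> T derived_set_of A" if "x \<in> A" for x
  proof -
    \<comment> \<open>This neighbourhood of \<open>x\<close> meets \<open>A\<close> only in
      \<open>x\<close>.\<close>
    have "openin T (topspace T - (A - {x}))"
      using assms[of "A - {x}"] by blast
    moreover have "x \<in> topspace T - (A - {x})"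
      using closedin_subset[OF assms[OF subset_refl]] that by blast
    ultimately show ?thesis
      by (auto simp: in_derived_set_of intro!: exI[of _ "topspace T - (A - {x})"])
  qed
  then show ?thesis
    unfolding discrete_set_def isolated_points_def by blast
qed

lemma submaximal_imp_nodec:
  assumes "submaximal T"
  shows "nodec T"
  unfolding nodec_def
proof (intro allI impI)
  fix A assume A: "A \<subseteq> topspace T" "nowhere_dense T A"
  have "closedin T B" if "B \<subseteq> A" for B
    using submaximal_nowhere_dense_closedin[OF assms subset_trans[OF that A(1)]]
      nowhere_dense_subset[OF A(2) that] by simp
  then show "closedin T A \<and> discrete_set T A"
    by (simp add: discrete_set_if_subsets_closedin)
qed

lemma scattered_derived_set_nowhere_dense:
  assumes "scattered T"
  shows "nowhere_dense T (T derived_set_of topspace T)"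
proof -
  let ?D = "T derived_set_of topspace T"
  let ?W = "T interior_of ?D"
  have "?W \<subseteq> T derived_set_of ?W"
  proof
    fix x assume x: "x \<in> ?W"
    then have "x \<in> ?D"
      using interior_of_subset[of T ?D] by blast
    then have "x \<in> ?W \<inter> ?D"
      using x by blast
    \<comment> \<open>Since \<open>?W\<close> is open, a neighbourhood of \<open>x\<close> can be
      shrunk into \<open>?W\<close>, so the points accumulating at \<open>x\<close> can be taken
      from \<open>?W\<close>.\<close>
    also have "\<dots> \<subseteq> T derived_set_of (?W \<inter> topspace T)"
      by (simp add: openin_Int_derived_set_of_subset)
    finally show "x \<in> T derived_set_of ?W"
      by (simp add: Int_absorb2 interior_of_subset_topspace)
  qed
  then have "?W = {}"
    using assms interior_of_subset_topspace[of T ?D] unfolding scattered_def by blast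
  then show ?thesis
    using closedin_derived_set_of_topspace[of T]
    by (simp add: nowhere_dense_def closure_of_closedin)
qed

lemma scattered_nodec_imp_I_space:
  assumes "scattered T" "nodec T"
  shows "I_space T"
  using assms scattered_derived_set_nowhere_dense[of T] derived_set_of_subset_topspace[of T]
  by (simp add: nodec_def I_space_def)

theorem proposition3p19:
  fixes T1 T2 :: "'a topology"
  assumes "bitopological_space T1 T2"
    and "coarser_topology T1 T2"
  shows "(scattered T1 \<longleftrightarrow> p_scattered T1 T2) \<and>
    (scattered T1 \<longrightarrow>
      (I_space T1 \<longleftrightarrow> d_submaximal T1 T2 \<and> p_submaximal T1 T2) \<and>
      (d_submaximal T1 T2 \<and> p_submaximal T1 T2 \<longleftrightarrow> nodec T1))"
proof -
  have X: "topspace T1 = topspace T2"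
    using assms(1) by (simp add: bitopological_space_def)
  have op: "openin T2 U" if "openin T1 U" for U
    using assms(2) that by (auto simp: coarser_topology_def)
  have cl: "closedin T2 F" if "closedin T1 F" for F
    using that op X by (auto simp: closedin_def)
  have "p_dense_in_itself T1 T2 B \<longleftrightarrow> B \<subseteq> T1 derived_set_of B" for B
    using derived_set_of_antimono_topology[OF X op, of B] unfolding p_dense_in_itself_iff by blast
  then have scat: "scattered T1 \<longleftrightarrow> p_scattered T1 T2"
    unfolding scattered_def p_scattered_def by simp
  have I_imp: "d_submaximal T1 T2 \<and> p_submaximal T1 T2" if "I_space T1"
  proof -
    \<comment> \<open>One pair valid in both topologies serves all four submaximality
      conditions.\<close>
    have "\<exists>U F. openin T1 U \<and> openin T2 U \<and> closedin T1 F \<and> closedin T2 F \<and> A = U \<inter> F"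
      if A: "A \<subseteq> topspace T1" for A
    proof -
      obtain U F where UF: "openin T1 U" "closedin T1 F" "A = U \<inter> F"
        using I_space_locally_closed[OF \<open>I_space T1\<close> A] .
      show ?thesis
        using UF op[OF UF(1)] cl[OF UF(2)] by (intro exI[of _ U] exI[of _ F]) simp
    qed
    then show ?thesis
      unfolding d_submaximal_def p_submaximal_def submaximal_def ij_submaximal_def X[symmetric]
      by (intro conjI allI impI) meson+
  qed
  have "nodec T1" if "d_submaximal T1 T2"
    using that submaximal_imp_nodec[of T1] by (simp add: d_submaximal_def)
  \<comment> \<open>The cycle (1), (2), (3), (1) closes here; scatteredness enters in the return
    from \<open>nodec\<close> to \<open>I_space\<close>.\<close>
  with scat I_imp show ?thesis
    using scattered_nodec_imp_I_space[of T1] by blast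
qed

end
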